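(* Let $G$ be a finite simple connected graph of order $n\ge 4$ and size $m$. If $G$ has $k$ pairwise edge-disjoint perfect matchings $M_1,\dots,M_k$ and, with $M=M_1\cup\cdots\cup M_k$, the graph $G\setminus M$ (vertex set $V(G)$, edge set $E(G)\setminus M$) is a connected spanning subgraph of $G$, then $\chi'_L(G)\le m-\frac{kn}{2}+k$.
   Context: For a proper edge coloring $c:E(G)\to\{1,\dots,k\}$ of $G$, let $\pi=(\mathcal{C}_1,\dots,\mathcal{C}_k)$ be the ordered partition of $E(G)$ into color classes. For a vertex $v$ and an edge $e=xy$, $d(v,e)=\min\{d(v,x),d(v,y)\}$, and $d(v,\mathcal{C}_i)=\min\{d(v,e): e\in\mathcal{C}_i\}$. The edge color code of $v$ is $c_\pi(v)=(d(v,\mathcal{C}_1),\dots,d(v,\mathcal{C}_k))$. The coloring is an edge-locating coloring if distinct vertices have distinct edge color codes; $\chi'_L(G)$ is the minimum number of colors in an edge-locating coloring of $G$. *)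

theory Defs
  imports Complex_Main "HOL-Library.Extended_Real" "HOL-Library.Disjoint_Sets"
begin

definition simple_graph :: "'a set \<Rightarrow> 'a set set \<Rightarrow> bool" where
  "simple_graph V E \<longleftrightarrow> finite V \<and> (\<forall>e\<in>E. e \<subseteq> V \<and> card e = 2)"

definition adj_rel :: "'a set set \<Rightarrow> ('a \<times> 'a) set" where
  "adj_rel E = {(x, y). {x, y} \<in> E \<and> x \<noteq> y}"

definition connected_graph :: "'a set \<Rightarrow> 'a set set \<Rightarrow> bool" where
  "connected_graph V E \<longleftrightarrow> V \<noteq> {} \<and> (\<forall>x\<in>V. \<forall>y\<in>V. (x, y) \<in> (adj_rel E)\<^sup>*)"

definition perfect_matching :: "'a set \<Rightarrow> 'a set set \<Rightarrow> 'a set set \<Rightarrow> bool" where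
  "perfect_matching V E M \<longleftrightarrow> M \<subseteq> E \<and> disjoint M \<and> \<Union>M = V"

(* Infima in enat are minima whenever the set is nonempty; vertices in different
   components are at distance \<infinity>. *)

definition vertex_dist :: "'a set set \<Rightarrow> 'a \<Rightarrow> 'a \<Rightarrow> enat" where
  "vertex_dist E u v = (INF l\<in>{l. (u, v) \<in> adj_rel E ^^ l}. enat l)"

definition edge_dist :: "'a set set \<Rightarrow> 'a \<Rightarrow> 'a set \<Rightarrow> enat" where
  "edge_dist E v e = (INF x\<in>e. vertex_dist E v x)"

definition class_dist :: "'a set set \<Rightarrow> 'a \<Rightarrow> 'a set set \<Rightarrow> enat" where
  "class_dist E v C = (INF e\<in>C. edge_dist E v e)"

definition color_class :: "'a set set \<Rightarrow> ('a set \<Rightarrow> nat) \<Rightarrow> nat \<Rightarrow> 'a set set" where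
  "color_class E c i = {e \<in> E. c e = i}"

(* Equality rather than inclusion of the image in {1..k}: the color classes are
   to form a partition of E, so each of the k classes is nonempty. *)
definition proper_edge_coloring :: "'a set set \<Rightarrow> nat \<Rightarrow> ('a set \<Rightarrow> nat) \<Rightarrow> bool" where
  "proper_edge_coloring E k c \<longleftrightarrow> c ` E = {1..k} \<and>
     (\<forall>e\<in>E. \<forall>f\<in>E. e \<noteq> f \<and> e \<inter> f \<noteq> {} \<longrightarrow> c e \<noteq> c f)"

definition edge_color_code :: "'a set set \<Rightarrow> nat \<Rightarrow> ('a set \<Rightarrow> nat) \<Rightarrow> 'a \<Rightarrow> enat list" where
  "edge_color_code E k c v = map (\<lambda>i. class_dist E v (color_class E c i)) [1..<Suc k]"

definition edge_locating_coloring :: "'a set \<Rightarrow> 'a set set \<Rightarrow> nat \<Rightarrow> ('a set \<Rightarrow> nat) \<Rightarrow> bool" where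
  "edge_locating_coloring V E k c \<longleftrightarrow>
     proper_edge_coloring E k c \<and> inj_on (edge_color_code E k c) V"

(* The value is \<infinity> when no edge-locating coloring exists (for instance for a
   single edge), so that a finite upper bound includes existence. *)
definition edge_locating_number :: "'a set \<Rightarrow> 'a set set \<Rightarrow> enat" where
  "edge_locating_number V E = (INF k\<in>{k. \<exists>c. edge_locating_coloring V E k c}. enat k)"

end

theory Submission imports Defs begin

text \<open>
  Let $H$ be the graph that remains after the $k$ matchings are deleted. Give each matching one
  color and each edge of $H$ a color of its own. A vertex has distance $0$ to a singleton class
  exactly if it is an end of its edge, so two vertices with equal codes have the same incident
  edges in $H$. Then no edge of $H$ leaves the pair, contradicting that $H$ is connected on more
  than two vertices.
\<close>

text \<open>A nonempty family in \<open>enat\<close> attains its infimum, and the empty one has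
  infimum \<infinity>. Zero distances thereby become statements about membership.\<close>

lemma INF_enat_eq_0_iff:
  fixes f :: "'b \<Rightarrow> enat"
  shows "(INF x\<in>A. f x) = 0 \<longleftrightarrow> (\<exists>x\<in>A. f x = 0)"
proof
  assume Inf0: "(INF x\<in>A. f x) = 0"
  then have "A \<noteq> {}" by (auto simp: top_enat_def)
  then have "Inf (f ` A) \<in> f ` A"
    by (auto simp: Inf_enat_def intro: LeastI)
  with Inf0 show "\<exists>x\<in>A. f x = 0" by auto
next
  assume "\<exists>x\<in>A. f x = 0"
  then show "(INF x\<in>A. f x) = 0"
    by (metis INF_lower le_zero_eq)
qed

lemma vertex_dist_eq_0_iff: "vertex_dist E u v = 0 \<longleftrightarrow> u = v"
  unfolding vertex_dist_def INF_enat_eq_0_iff by (simp add: enat_0_iff)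

lemma class_dist_eq_0_iff: "class_dist E v C = 0 \<longleftrightarrow> v \<in> \<Union>C"
  by (auto simp: class_dist_def edge_dist_def INF_enat_eq_0_iff vertex_dist_eq_0_iff)

text \<open>Of a code only the positions of its zeros are used: by
  \<open>class_dist_eq_0_iff\<close>, entry \<open>i\<close> is 0 exactly at the vertices covered by
  class \<open>i\<close>.\<close>

lemma edge_color_code_eqD:
  assumes "edge_color_code E k c u = edge_color_code E k c v" and "i \<in> {1..k}"
  shows "u \<in> \<Union>(color_class E c i) \<longleftrightarrow> v \<in> \<Union>(color_class E c i)"
proof -
  have "class_dist E u (color_class E c i) = class_dist E v (color_class E c i)"
    using assms unfolding edge_color_code_def by (auto simp: map_eq_conv simp del: upt_Suc)
  then show ?thesis by (metis class_dist_eq_0_iff)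
qed

lemma connected_graph_same_incident_edges:
  assumes conn: "connected_graph V H" and "card V > 2"
    and "u \<in> V" "v \<in> V" and same: "\<And>e. e \<in> H \<Longrightarrow> u \<in> e \<longleftrightarrow> v \<in> e"
  shows "u = v"
proof (rule ccontr)
  assume "u \<noteq> v"
  have "w \<in> {u, v}" if "(u, w) \<in> (adj_rel H)\<^sup>*" for w
    using that
  proof induction
    \<comment> \<open>The edge \<open>{x, y}\<close> meets \<open>{u, v}\<close>, so by
      \<open>same\<close> it contains both \<open>u\<close> and \<open>v\<close> and equals
      \<open>{u, v}\<close>; the walk cannot leave the pair.\<close>
    case (step x y)
    then have "{x, y} \<in> H" "x \<in> {u, v}" by (auto simp: adj_rel_def)
    with same[of "{x, y}"] \<open>u \<noteq> v\<close> show ?case by auto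
  qed auto
  then have "V \<subseteq> {u, v}"
    using conn \<open>u \<in> V\<close> unfolding connected_graph_def by blast
  then have "card V \<le> card {u, v}" by (intro card_mono) auto
  with \<open>u \<noteq> v\<close> \<open>card V > 2\<close> show False by simp
qed

text \<open>Distances are taken in \<open>E\<close>, but their zeros depend on incidence alone, so
  connectedness of the subgraph \<open>H\<close> can be applied directly.\<close>

lemma edge_locating_coloringI:
  assumes "proper_edge_coloring E k c"
    and "H \<subseteq> E" "connected_graph V H" "card V > 2"
    and "\<And>e f. e \<in> H \<Longrightarrow> f \<in> E \<Longrightarrow> c e = c f \<Longrightarrow> e = f"
  shows "edge_locating_coloring V E k c"
  unfolding edge_locating_coloring_def
proof (intro conjI inj_onI)
  fix u v assume uv: "u \<in> V" "v \<in> V" and code: "edge_color_code E k c u = edge_color_code E k c v"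
  have "u \<in> e \<longleftrightarrow> v \<in> e" if "e \<in> H" for e
  proof -
    have "color_class E c (c e) = {e}"
      using that assms by (fastforce simp: color_class_def)
    moreover have "c e \<in> {1..k}"
      using imageI[of e E c] that assms(2) assms(1)[unfolded proper_edge_coloring_def] by blast
    ultimately show ?thesis using edge_color_code_eqD[OF code, of "c e"] by simp
  qed
  then show "u = v"
    using connected_graph_same_incident_edges assms uv by metis
qed fact

lemma edge_locating_number_le:
  "edge_locating_coloring V E k c \<Longrightarrow> edge_locating_number V E \<le> enat k"
  unfolding edge_locating_number_def by (rule INF_lower) auto

lemma card_perfect_matching:
  assumes "simple_graph V E" "perfect_matching V E M"
  shows "card V = 2 * card M"
proof -
  have "card (\<Union>M) = (\<Sum>e\<in>M. card e)"
    using assms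
    by (intro card_Union_disjoint)
      (auto simp: perfect_matching_def simple_graph_def disjoint_def pairwise_def disjnt_def
        intro: finite_subset)
  also have "\<dots> = (\<Sum>e\<in>M. 2)"
    using assms by (intro sum.cong) (auto simp: perfect_matching_def simple_graph_def)
  finally show ?thesis using assms by (simp add: perfect_matching_def)
qed

lemma simple_graph_finite_edges: "simple_graph V E \<Longrightarrow> finite E"
  by (rule finite_subset[of _ "Pow V"]) (auto simp: simple_graph_def)

text \<open>Colors 1 to \<open>k\<close> go to the matchings, and the next \<open>card H\<close>
  colors go bijectively to the edges of \<open>H\<close>.\<close>

lemma matching_edge_coloring:
  fixes M :: "nat \<Rightarrow> 'a set set"
  assumes "finite E" "V \<noteq> {}"
    and pm: "\<And>i. i \<in> {1..k} \<Longrightarrow> perfect_matching V E (M i)"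
    and disj: "disjoint_family_on M {1..k}"
  defines "H \<equiv> E - (\<Union>i\<in>{1..k}. M i)"
  obtains c where "proper_edge_coloring E (k + card H) c"
    and "\<And>e f. e \<in> H \<Longrightarrow> f \<in> E \<Longrightarrow> c e = c f \<Longrightarrow> e = f"
proof -
  have "finite H" using \<open>finite E\<close> by (simp add: H_def)
  then obtain h where h: "bij_betw h H {k+1..k + card H}"
    using finite_same_card_bij[of H "{k+1..k + card H}"] by auto
  \<comment> \<open>Disjointness of the family makes the index \<open>i\<close> unique for an edge
    of a matching.\<close>
  define c where "c e = (if e \<in> H then h e else THE i. i \<in> {1..k} \<and> e \<in> M i)" for e
  have c_H: "c e = h e" "c e \<in> {k+1..k + card H}" if "e \<in> H" for e
    using that h by (auto simp: c_def bij_betw_def)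
  have c_M: "c e = i" if "i \<in> {1..k}" "e \<in> M i" for e i
  proof -
    have "e \<notin> H" using that by (auto simp: H_def)
    moreover have "j = i" if "j \<in> {1..k}" "e \<in> M j" for j
      using disjoint_family_onD[OF disj, of j i] that \<open>i \<in> {1..k}\<close> \<open>e \<in> M i\<close> by auto
    ultimately have "(THE i. i \<in> {1..k} \<and> e \<in> M i) = i"
      using that by (intro the_equality) blast+
    with \<open>e \<notin> H\<close> show ?thesis by (simp add: c_def)
  qed
  \<comment> \<open>A matching that covers the nonempty \<open>V\<close> has an edge, so color
    \<open>i\<close> really occurs, as a proper coloring onto \<open>{1..k + card H}\<close>
    demands.\<close>
  have sub: "M i \<subseteq> E" "M i \<noteq> {}" if "i \<in> {1..k}" for i
    using pm[OF that] \<open>V \<noteq> {}\<close> by (auto simp: perfect_matching_def)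
  have E_cases: "(e \<in> H) \<or> (\<exists>i\<in>{1..k}. e \<in> M i)" if "e \<in> E" for e
    using that by (auto simp: H_def)
  have inj: "e = f" if "e \<in> H" "f \<in> E" "c e = c f" for e f
  proof -
    \<comment> \<open>Otherwise \<open>f\<close> lies in a matching and has color at most
      \<open>k\<close>, whereas \<open>c e\<close> exceeds \<open>k\<close>.\<close>
    have "f \<in> H"
      using E_cases[OF \<open>f \<in> E\<close>] c_M[of _ f] c_H(2)[OF \<open>e \<in> H\<close>] that(3) by force
    then show ?thesis using that h c_H(1) by (metis bij_betw_imp_inj_on inj_onD)
  qed
  have "c ` E = {1..k + card H}"
  proof
    show "c ` E \<subseteq> {1..k + card H}"
      using E_cases c_M c_H(2) by fastforce
    show "{1..k + card H} \<subseteq> c ` E"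
    proof
      fix i assume i: "i \<in> {1..k + card H}"
      show "i \<in> c ` E"
      proof (cases "i \<le> k")
        case True
        with i have ik: "i \<in> {1..k}" by simp
        with sub obtain e where "e \<in> M i" "e \<in> E" by blast
        with c_M[OF ik] show ?thesis by force
      next
        case False
        with i have "i \<in> h ` H" using h by (auto simp: bij_betw_def)
        then show ?thesis using c_H(1) by (force simp: H_def)
      qed
    qed
  qed
  moreover have "c e \<noteq> c f" if "e \<in> E" "f \<in> E" "e \<noteq> f" "e \<inter> f \<noteq> {}" for e f
  proof
    assume eq: "c e = c f"
    \<comment> \<open>An edge of \<open>H\<close> shares its color with no other edge, so both edges
      lie in matchings, and equal colors put them in the same one.\<close>
    with that inj[of e f] inj[of f e] have "e \<notin> H" "f \<notin> H" by auto
    with that E_cases obtain i j where i: "i \<in> {1..k}" "e \<in> M i" and j: "j \<in> {1..k}" "f \<in> M j"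
      by metis
    with eq c_M have "i = j" by metis
    with i j pm[of i] have "e \<inter> f = {}"
      using \<open>e \<noteq> f\<close> by (auto simp: perfect_matching_def disjoint_def)
    with that show False by simp
  qed
  ultimately have "proper_edge_coloring E (k + card H) c"
    by (auto simp: proper_edge_coloring_def)
  with inj show ?thesis using that by blast
qed

theorem theorem15:
  fixes V :: "'a set" and E :: "'a set set" and M :: "nat \<Rightarrow> 'a set set" and n m k :: nat
  assumes "simple_graph V E"
    and "connected_graph V E"
    and "card V = n" and "n \<ge> 4" and "card E = m"
    and "\<forall>i\<in>{1..k}. perfect_matching V E (M i)"
    and "disjoint_family_on M {1..k}"
    and "connected_graph V (E - (\<Union>i\<in>{1..k}. M i))"
  shows "ereal_of_enat (edge_locating_number V E) \<le> ereal (real m - real k * real n / 2 + real k)"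
proof -
  let ?U = "\<Union>i\<in>{1..k}. M i"
  let ?H = "E - ?U"
  have "finite E" using assms(1) by (rule simple_graph_finite_edges)
  have "V \<noteq> {}" using assms(3,4) by auto
  have sub: "M i \<subseteq> E" if "i \<in> {1..k}" for i
    using assms(6) that by (auto simp: perfect_matching_def)
  obtain c where "proper_edge_coloring E (k + card ?H) c"
    and "\<And>e f. e \<in> ?H \<Longrightarrow> f \<in> E \<Longrightarrow> c e = c f \<Longrightarrow> e = f"
    using matching_edge_coloring[OF \<open>finite E\<close> \<open>V \<noteq> {}\<close>] assms(6,7) by metis
  then have "edge_locating_coloring V E (k + card ?H) c"
    \<comment> \<open>Here \<open>n \<ge> 4\<close> supplies the more than two vertices.\<close>
    using assms by (intro edge_locating_coloringI[where H = ?H]) auto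
  then have le: "edge_locating_number V E \<le> enat (k + card ?H)"
    by (rule edge_locating_number_le)
  have "card ?U = (\<Sum>i\<in>{1..k}. card (M i))"
    using finite_subset[OF sub \<open>finite E\<close>] disjoint_family_onD[OF assms(7)]
    by (intro card_UN_disjoint) auto
  \<comment> \<open>Counting twice the matching edges keeps the computation in \<open>nat\<close>
    free of division; the half appears only in the reals.\<close>
  then have "2 * card ?U = (\<Sum>i\<in>{1..k}. 2 * card (M i))"
    by (simp add: sum_distrib_left)
  also have "\<dots> = (\<Sum>i\<in>{1..k}. n)"
    using card_perfect_matching[OF assms(1)] assms(3,6) by (intro sum.cong) metis+
  finally have U: "2 * card ?U = k * n" by simp
  have "?U \<subseteq> E" using sub by blast
  then have "card ?U + card ?H = m"
    using \<open>finite E\<close> assms(5) by (metis card_mono card_Diff_subset finite_subset le_add_diff_inverse)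
  then have "real (k + card ?H) = real m - real k * real n / 2 + real k"
    using arg_cong[OF U, of real] by (simp flip: of_nat_add)
  with le show ?thesis
    by (metis ereal_of_enat_le_iff ereal_of_enat_simps(1))
qed

end
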